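(* Let $X_1,\dots,X_n$ be random variables on a common probability space, and let $\alpha_1,\dots,\alpha_n\ge 0$, $r>0$ and $K>0$ be real numbers. Assume that for all $k,m$ with $1\le k\le m\le n$ and all $\varepsilon>0$ $$\mathbb{P}\Big(\max_{k\le l\le m}|X_k+\dots+X_l|\ge\varepsilon\Big)\le\frac{K}{\varepsilon^r}\sum_{l=k}^m\alpha_l .$$ Then for every non-decreasing sequence $\beta_1\le\dots\le\beta_n$ of positive numbers, every $m$ with $1\le m\le n$ and every $\varepsilon>0$ $$\mathbb{P}\left(\max_{m\le l\le n}\left|\frac{S_l}{\beta_l}\right|\ge\varepsilon\right)\le\frac{C}{\varepsilon^r}\left[\frac{1}{\beta_m^r}\sum_{l=1}^m\alpha_l+\sum_{l=m+1}^n\frac{\alpha_l}{\beta_l^r}\right]$$ with $C=(1+\sqrt[r]{4})^r K$, where $\sqrt[r]{4}=4^{1/r}$.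
   Context: $S_l=X_1+\dots+X_l$ denotes the partial sums. No assumption is made on the dependence structure of the random variables. An empty sum equals $0$. *)

theory Defs
  imports "HOL-Probability.Probability"
begin

end

theory Submission
  imports Defs
begin

text \<open>
  Replacing \<open>\<beta> l\<close> by \<open>\<beta> m\<close> for \<open>l < m\<close> reduces the claim to \<open>m = 1\<close>. Then cut the indices into
  the dyadic blocks \<open>2 ^ i \<le> (\<beta> l / \<beta> 1) powr r < 2 ^ (i + 1)\<close>, apply the maximal inequality up to the
  end of each block, and exchange the order of summation: the weight \<open>\<alpha> l\<close> is counted with
  a geometric series that starts at the block of \<open>l\<close>, hence is at most
  \<open>4 / (\<beta> l / \<beta> 1) powr r\<close>. Finally \<open>4 \<le> (1 + 4 powr (1 / r)) powr r\<close>.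
\<close>

lemma ex_dyadic_block:
  fixes t :: real
  assumes "1 \<le> t"
  obtains i :: nat where "2 ^ i \<le> t" "t < 2 ^ Suc i"
proof -
  obtain N :: nat where N: "t < 2 ^ N"
    using real_arch_pow[of 2 t] by auto
  define j where "j = (LEAST j::nat. t < 2 ^ j)"
  have j: "t < 2 ^ j"
    unfolding j_def using N by (rule LeastI)
  with assms have "j \<noteq> 0"
    by (intro notI) simp
  then obtain i where i: "j = Suc i"
    using not0_implies_Suc by blast
  then have "\<not> t < 2 ^ i"
    using not_less_Least[of i "\<lambda>j. t < 2 ^ j"] by (simp add: j_def)
  with that j i show ?thesis
    by (metis not_less)
qed

text \<open>The first index \<open>i\<close> that contributes satisfies
  \<open>2 ^ i > t / 2\<close>, and a geometric series of ratio 1/2 is at most twice its first term,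
  which is below \<open>2 / t\<close>.\<close>

lemma dyadic_tail_sum:
  fixes t :: real
  assumes "0 < t"
  shows "(\<Sum>i\<le>N::nat. if t < 2 ^ Suc i then 1 / 2 ^ i else 0) \<le> 4 / t"
proof -
  let ?s = "\<lambda>N::nat. \<Sum>i\<le>N. if t < 2 ^ Suc i then 1 / 2 ^ i else (0::real)"
  \<comment> \<open>The bound is sharpened so that the induction closes: the subtracted
    \<open>1 / 2 ^ N\<close> is the tail of the geometric series beyond \<open>N\<close>, kept in
    reserve for the terms still to come.\<close>
  have "?s N \<le> (if t < 2 ^ Suc N then 4 / t - 1 / 2 ^ N else 0)"
  proof (induction N)
    case 0
    show ?case using assms by (simp add: field_simps)
  next
    case (Suc N)
    show ?case
    proof (cases "t < 2 ^ Suc N")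
      case True
      then have "t < 2 ^ Suc (Suc N)"
        using assms by simp
      moreover have "1 / 2 ^ N = 2 * (1 / 2 ^ Suc N :: real)"
        by simp
      moreover have "?s (Suc N) = ?s N + 1 / 2 ^ Suc N"
        using \<open>t < 2 ^ Suc (Suc N)\<close> by simp
      ultimately show ?thesis
        using True Suc by (simp del: sum.atMost_Suc power_Suc)
    next
      case False
      \<comment> \<open>Here all earlier terms vanish, so at most the first nonzero term is
        added.\<close>
      have "1 / 2 ^ Suc N \<le> 4 / t - 1 / 2 ^ Suc N" if "t < 2 ^ Suc (Suc N)"
        using assms that by (simp add: field_simps)
      with False Suc show ?thesis
        by auto
    qed
  qed
  also have "\<dots> \<le> 4 / t"
    using assms by auto
  finally show ?thesis .
qed

text \<open>The case \<open>m = 1\<close>, with the constant 4 coming from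
  \<open>dyadic_tail_sum\<close>. The general case follows by applying it to weights that are
  constant up to \<open>m\<close>.\<close>

lemma (in finite_measure) Hajek_Renyi_of_Kolmogorov:
  fixes S :: "nat \<Rightarrow> 'a \<Rightarrow> real" and \<alpha> \<beta> :: "nat \<Rightarrow> real"
  assumes meas: "\<And>l. l \<in> {1..n} \<Longrightarrow> S l \<in> borel_measurable M"
    and \<alpha>: "\<And>l. l \<in> {1..n} \<Longrightarrow> 0 \<le> \<alpha> l"
    and r: "0 < r" and K: "0 \<le> K"
    and maximal: "\<And>m \<delta>. m \<in> {1..n} \<Longrightarrow> 0 < \<delta> \<Longrightarrow>
      measure M {\<omega> \<in> space M. \<exists>l\<in>{1..m}. \<delta> \<le> \<bar>S l \<omega>\<bar>} \<le> K / \<delta> powr r * (\<Sum>l=1..m. \<alpha> l)"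
    and mono: "mono_on {1..n} \<beta>" and pos: "\<And>l. l \<in> {1..n} \<Longrightarrow> 0 < \<beta> l"
    and \<epsilon>: "0 < \<epsilon>"
  shows "measure M {\<omega> \<in> space M. \<exists>l\<in>{1..n}. \<epsilon> \<le> \<bar>S l \<omega> / \<beta> l\<bar>}
    \<le> 4 * K / \<epsilon> powr r * (\<Sum>l=1..n. \<alpha> l / \<beta> l powr r)"
proof (cases "n = 0")
  case True
  then show ?thesis by simp
next
  case False
  then have n1: "1 \<in> {1..n}" "n \<in> {1..n}"
    by auto
  \<comment> \<open>Normalised so that \<open>t 1 = 1\<close>; the power \<open>r\<close> matches
    the factor \<open>1 / \<delta> powr r\<close> in the maximal inequality.\<close>
  define t where "t l = (\<beta> l / \<beta> 1) powr r" for l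
  have \<beta>1: "0 < \<beta> 1"
    using pos n1 by blast
  have t_mono: "t k \<le> t l" if "k \<in> {1..n}" "l \<in> {1..n}" "k \<le> l" for k l
  proof -
    have "\<beta> k \<le> \<beta> l"
      using mono_onD[OF mono that] .
    then show ?thesis
      unfolding t_def using r \<beta>1 pos[OF that(1)]
      by (intro powr_mono2) (auto simp: divide_right_mono)
  qed
  have t_1: "t 1 = 1"
    using \<beta>1 by (simp add: t_def)
  have t_ge_1: "1 \<le> t l" if "l \<in> {1..n}" for l
    using t_mono[of 1 l] that n1 t_1 by auto
  obtain N where N: "t n < 2 ^ Suc N"
    using ex_dyadic_block[OF t_ge_1[OF n1(2)]] by blast
  \<comment> \<open>\<open>L i\<close> holds all indices up to the end of block \<open>i\<close>,
    not just the block, so that the maximal inequality from index 1 applies. The level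
    \<open>\<delta> i\<close> is \<epsilon> times the least value that \<beta> can take in block
    \<open>i\<close>.\<close>
  define L where "L i = {l \<in> {1..n}. t l < 2 ^ Suc i}" for i
  define \<delta> where "\<delta> i = \<epsilon> * \<beta> 1 * (2 ^ i) powr (1 / r)" for i :: nat
  define E where "E i = {\<omega> \<in> space M. \<exists>l\<in>L i. \<delta> i \<le> \<bar>S l \<omega>\<bar>}" for i
  have \<delta>_pos: "0 < \<delta> i" for i
    using \<epsilon> \<beta>1 by (simp add: \<delta>_def)
  have \<delta>_powr: "\<delta> i powr r = \<epsilon> powr r * \<beta> 1 powr r * 2 ^ i" for i
    using \<epsilon> \<beta>1 r by (simp add: \<delta>_def powr_mult powr_powr)
  \<comment> \<open>Monotonicity of \<open>t\<close> makes \<open>L i\<close> an initial segment. It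
    contains 1 even when block \<open>i\<close> is empty, so \<open>Max\<close> is
    meaningful.\<close>
  have L_eq: "L i = {1..Max (L i)}" and Max_L: "Max (L i) \<in> {1..n}" for i
  proof -
    have fin: "finite (L i)" and "1 \<in> L i"
      using n1 t_1 by (auto simp: L_def less_le_trans[of 1 2] simp del: power_Suc intro!: one_less_power)
    then have M: "Max (L i) \<in> L i"
      by (intro Max_in) auto
    then show "Max (L i) \<in> {1..n}"
      by (simp add: L_def)
    show "L i = {1..Max (L i)}"
    proof (intro equalityI subsetI)
      fix l assume "l \<in> L i"
      then show "l \<in> {1..Max (L i)}"
        using fin by (auto simp: L_def)
    next
      fix l assume l: "l \<in> {1..Max (L i)}"
      with M have "l \<in> {1..n}"
        by (auto simp: L_def)
      with M l t_mono[of l "Max (L i)"] show "l \<in> L i"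
        by (auto simp: L_def simp del: power_Suc)
    qed
  qed
  have E_bound: "measure M (E i) \<le> K / (\<epsilon> powr r * \<beta> 1 powr r) * (\<Sum>l\<in>L i. \<alpha> l / 2 ^ i)" for i
    using maximal[OF Max_L[of i] \<delta>_pos[of i], folded L_eq]
    by (simp add: E_def \<delta>_powr sum_divide_distrib[symmetric])
  have E_sets: "E i \<in> sets M" for i
  proof -
    have [measurable]: "S l \<in> borel_measurable M" if "l \<in> L i" for l
      using meas that by (simp add: L_def)
    have [simp]: "finite (L i)"
      by (simp add: L_def)
    have "E i = (\<Union>l\<in>L i. {\<omega> \<in> space M. \<delta> i \<le> \<bar>S l \<omega>\<bar>})"
      by (auto simp: E_def)
    also have "\<dots> \<in> sets M"
      by (intro sets.finite_UN) auto
    finally show ?thesis .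
  qed
  \<comment> \<open>If the event occurs at \<open>l\<close> in block \<open>i\<close>, then
    \<epsilon> * \<beta> l is at least \<open>\<delta> i\<close>, so \<open>E i\<close> occurs;
    \<open>i\<close> is at most \<open>N\<close> because \<open>t l \<le> t n\<close>.\<close>
  have cover: "{\<omega> \<in> space M. \<exists>l\<in>{1..n}. \<epsilon> \<le> \<bar>S l \<omega> / \<beta> l\<bar>} \<subseteq> (\<Union>i\<le>N. E i)"
  proof safe
    fix \<omega> l assume \<omega>: "\<omega> \<in> space M" and l: "l \<in> {1..n}" and ge: "\<epsilon> \<le> \<bar>S l \<omega> / \<beta> l\<bar>"
    obtain i where i: "2 ^ i \<le> t l" "t l < 2 ^ Suc i"
      using ex_dyadic_block[OF t_ge_1[OF l]] by blast
    have "(2::real) ^ i < 2 ^ Suc N"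
      using i(1) t_mono[OF l n1(2)] l N by (meson atLeastAtMost_iff le_less_trans)
    then have "i < Suc N"
      by (simp del: power_Suc)
    have "(2 ^ i) powr (1 / r) \<le> t l powr (1 / r)"
      using i(1) r by (intro powr_mono2) auto
    also have "\<dots> = \<beta> l / \<beta> 1"
      using r \<beta>1 pos[OF l] by (simp add: t_def powr_powr)
    finally have "\<beta> 1 * (2 ^ i) powr (1 / r) \<le> \<beta> l"
      using \<beta>1 by (simp add: field_simps)
    then have "\<delta> i \<le> \<epsilon> * \<beta> l"
      using \<epsilon> by (simp add: \<delta>_def mult.assoc)
    also have "\<dots> \<le> \<bar>S l \<omega>\<bar>"
      using ge pos[OF l] by (simp add: abs_divide field_simps)
    finally have "\<omega> \<in> E i"
      using \<omega> l i(2) by (auto simp: E_def L_def)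
    with \<open>i < Suc N\<close> show "\<omega> \<in> (\<Union>i\<le>N. E i)"
      by auto
  qed
  have "measure M {\<omega> \<in> space M. \<exists>l\<in>{1..n}. \<epsilon> \<le> \<bar>S l \<omega> / \<beta> l\<bar>} \<le> measure M (\<Union>i\<le>N. E i)"
    using cover E_sets by (intro finite_measure_mono) auto
  also have "\<dots> \<le> (\<Sum>i\<le>N. measure M (E i))"
    using E_sets by (intro finite_measure_subadditive_finite) auto
  also have "\<dots> \<le> (\<Sum>i\<le>N. K / (\<epsilon> powr r * \<beta> 1 powr r) * (\<Sum>l\<in>L i. \<alpha> l / 2 ^ i))"
    by (intro sum_mono E_bound)
  \<comment> \<open>Padding with zeros makes the inner range independent of \<open>i\<close>, ready
    for the exchange of sums.\<close>
  also have "\<dots> = K / (\<epsilon> powr r * \<beta> 1 powr r) *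
      (\<Sum>i\<le>N. \<Sum>l=1..n. \<alpha> l * (if t l < 2 ^ Suc i then 1 / 2 ^ i else 0))"
    unfolding sum_distrib_left[symmetric] L_def
    by (intro arg_cong2[where f = times] refl sum.cong sum.mono_neutral_cong_left) auto
  also have "\<dots> = K / (\<epsilon> powr r * \<beta> 1 powr r) *
      (\<Sum>l=1..n. \<alpha> l * (\<Sum>i\<le>N. if t l < 2 ^ Suc i then 1 / 2 ^ i else 0))"
    by (subst sum.swap) (simp only: sum_distrib_left)
  also have "\<dots> \<le> K / (\<epsilon> powr r * \<beta> 1 powr r) * (\<Sum>l=1..n. \<alpha> l * (4 / t l))"
    using K \<alpha> t_ge_1 by (intro mult_left_mono sum_mono dyadic_tail_sum) fastforce+
  also have "\<dots> = 4 * K / \<epsilon> powr r * (\<Sum>l=1..n. \<alpha> l / \<beta> l powr r)"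
    unfolding sum_distrib_left
  proof (intro sum.cong refl)
    fix l assume "l \<in> {1..n}"
    then show "K / (\<epsilon> powr r * \<beta> 1 powr r) * (\<alpha> l * (4 / t l)) = 4 * K / \<epsilon> powr r * (\<alpha> l / \<beta> l powr r)"
      using \<beta>1 pos[of l] by (simp add: t_def powr_divide)
  qed
  finally show ?thesis .
qed

theorem theorem4p3:
  fixes M :: "'a measure" and X :: "nat \<Rightarrow> 'a \<Rightarrow> real"
    and n :: nat and \<alpha> :: "nat \<Rightarrow> real" and r K :: real
  assumes "prob_space M"
    and "\<And>i. i \<in> {1..n} \<Longrightarrow> X i \<in> borel_measurable M"
    and "\<And>i. i \<in> {1..n} \<Longrightarrow> \<alpha> i \<ge> 0"
    and "r > 0" and "K > 0"
    and "\<And>k m \<epsilon>. 1 \<le> k \<Longrightarrow> k \<le> m \<Longrightarrow> m \<le> n \<Longrightarrow> \<epsilon> > 0 \<Longrightarrow>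
           \<P>(\<omega> in M. (MAX l\<in>{k..m}. \<bar>\<Sum>i=k..l. X i \<omega>\<bar>) \<ge> \<epsilon>)
             \<le> K / \<epsilon> powr r * (\<Sum>l=k..m. \<alpha> l)"
  shows "\<forall>\<beta> :: nat \<Rightarrow> real. mono_on {1..n} \<beta> \<longrightarrow> (\<forall>i\<in>{1..n}. \<beta> i > 0) \<longrightarrow>
           (\<forall>m\<in>{1..n}. \<forall>\<epsilon>>0.
              \<P>(\<omega> in M. (MAX l\<in>{m..n}. \<bar>(\<Sum>i=1..l. X i \<omega>) / \<beta> l\<bar>) \<ge> \<epsilon>)
                \<le> (1 + 4 powr (1 / r)) powr r * K / \<epsilon> powr r
                   * (1 / \<beta> m powr r * (\<Sum>l=1..m. \<alpha> l) + (\<Sum>l=m+1..n. \<alpha> l / \<beta> l powr r)))"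
proof (intro allI impI ballI)
  fix \<beta> :: "nat \<Rightarrow> real" and m \<epsilon>
  assume mono: "mono_on {1..n} \<beta>" and pos: "\<forall>i\<in>{1..n}. 0 < \<beta> i"
    and m: "m \<in> {1..n}" and \<epsilon>: "0 < (\<epsilon>::real)"
  interpret prob_space M by fact
  define S where "S l \<omega> = (\<Sum>i=1..l. X i \<omega>)" for l \<omega>
  \<comment> \<open>Flattening the weights below \<open>m\<close> keeps them monotone and turns the
    weighted sum into exactly the bracket \<open>R\<close> of the claim.\<close>
  define b where "b l = \<beta> (max l m)" for l
  define R where "R = 1 / \<beta> m powr r * (\<Sum>l=1..m. \<alpha> l) + (\<Sum>l=m+1..n. \<alpha> l / \<beta> l powr r)"
  have meas: "S l \<in> borel_measurable M" if "l \<in> {1..n}" for l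
    unfolding S_def using assms(2) that by (intro borel_measurable_sum) auto
  have maximal: "prob {\<omega> \<in> space M. \<exists>l\<in>{1..k}. \<delta> \<le> \<bar>S l \<omega>\<bar>} \<le> K / \<delta> powr r * (\<Sum>l=1..k. \<alpha> l)"
    if "k \<in> {1..n}" "0 < \<delta>" for k \<delta>
    using assms(6)[of 1 k \<delta>] that by (simp add: S_def Max_ge_iff)
  have b_mono: "mono_on {1..n} b"
    unfolding b_def using m by (intro mono_onI mono_onD[OF mono]) auto
  have b_pos: "0 < b l" if "l \<in> {1..n}" for l
    using pos m that by (auto simp: b_def max_def)
  have "{1..n} = {1..m} \<union> {m+1..n}"
    using m by auto
  then have R_eq: "(\<Sum>l=1..n. \<alpha> l / b l powr r) = R"
    by (simp add: sum.union_disjoint R_def b_def sum_divide_distrib max_def)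
  have "0 \<le> R"
    unfolding R_eq[symmetric] using assms(3) by (intro sum_nonneg) simp
  \<comment> \<open>Passes from the constant 4 of the lemma to the larger one in the claim.\<close>
  have four_le: "4 \<le> (1 + 4 powr (1 / r)) powr r"
  proof -
    have "(4 powr (1 / r)) powr r \<le> (1 + 4 powr (1 / r)) powr r"
      using \<open>r > 0\<close> by (intro powr_mono2) auto
    then show ?thesis
      using \<open>r > 0\<close> by (simp add: powr_powr)
  qed
  \<comment> \<open>\<open>b\<close> and \<beta> agree from \<open>m\<close> on, so admitting the
    indices below \<open>m\<close> only enlarges the event.\<close>
  have "{\<omega> \<in> space M. \<epsilon> \<le> (MAX l\<in>{m..n}. \<bar>S l \<omega> / \<beta> l\<bar>)}
      \<subseteq> {\<omega> \<in> space M. \<exists>l\<in>{1..n}. \<epsilon> \<le> \<bar>S l \<omega> / b l\<bar>}"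
    using m by (force simp: Max_ge_iff b_def max_def)
  moreover have "{\<omega> \<in> space M. \<exists>l\<in>{1..n}. \<epsilon> \<le> \<bar>S l \<omega> / b l\<bar>} \<in> events"
  proof -
    have [measurable]: "S l \<in> borel_measurable M" if "l \<in> {1..n}" for l
      using meas that .
    have "{\<omega> \<in> space M. \<exists>l\<in>{1..n}. \<epsilon> \<le> \<bar>S l \<omega> / b l\<bar>}
        = (\<Union>l\<in>{1..n}. {\<omega> \<in> space M. \<epsilon> \<le> \<bar>S l \<omega> / b l\<bar>})"
      by auto
    also have "\<dots> \<in> events"
      by (intro sets.finite_UN) auto
    finally show ?thesis .
  qed
  ultimately have "prob {\<omega> \<in> space M. \<epsilon> \<le> (MAX l\<in>{m..n}. \<bar>S l \<omega> / \<beta> l\<bar>)}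
      \<le> prob {\<omega> \<in> space M. \<exists>l\<in>{1..n}. \<epsilon> \<le> \<bar>S l \<omega> / b l\<bar>}"
    by (rule finite_measure_mono)
  also have "\<dots> \<le> 4 * K / \<epsilon> powr r * R"
    unfolding R_eq[symmetric] using assms(3,4,5) meas maximal b_mono b_pos \<epsilon>
    by (intro Hajek_Renyi_of_Kolmogorov) auto
  also have "\<dots> \<le> (1 + 4 powr (1 / r)) powr r * K / \<epsilon> powr r * R"
    using four_le \<open>K > 0\<close> \<open>0 \<le> R\<close>
    by (intro mult_right_mono divide_right_mono) auto
  finally show "\<P>(\<omega> in M. (MAX l\<in>{m..n}. \<bar>(\<Sum>i=1..l. X i \<omega>) / \<beta> l\<bar>) \<ge> \<epsilon>)
      \<le> (1 + 4 powr (1 / r)) powr r * K / \<epsilon> powr r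
         * (1 / \<beta> m powr r * (\<Sum>l=1..m. \<alpha> l) + (\<Sum>l=m+1..n. \<alpha> l / \<beta> l powr r))"
    by (simp add: S_def R_def)
qed

end
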